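(* The operad $\mathsf{C}\mathbb{D}_0^2$ is isomorphic to the suboperad of $\mathsf{DMT}$ consisting in the linear span of all double multi-tildes except the three nontrivial double multi-tildes of arity $1$ (those of arity $1$ different from $(1,\emptyset,\emptyset)$). Moreover, $\phi_{\mathsf{DMT}}$ is an isomorphism between these two operads (from the said suboperad of $\mathsf{DMT}$ to $\mathsf{C}\mathbb{D}_0^2$).
   Context: Let $\mathbb{K}$ be a field of characteristic zero and $[n]=\{1,\dots,n\}$. Operads are nonsymmetric operads in $\mathbb{K}$-vector spaces (graded from arity $1$, with partial compositions $\circ_i$ and a unit of arity $1$); operad morphisms are linear maps that respect arities, units and partial compositions. $\mathbb{D}_0=\{\mathbb{1},0\}$ is the unitary magma with unit $\mathbb{1}$ and absorbing element $0$ (so $0\star0=0$), and $\mathbb{D}_0^2=\mathbb{D}_0\times\mathbb{D}_0$ is its Cartesian square with componentwise operation and unit $(\mathbb{1},\mathbb{1})$. For a unitary magma $\mathcal{M}$ with operation $\star$ and unit $\mathbb{1}_{\mathcal{M}}$, an $\mathcal{M}$-clique of arity $n\ge1$ is a map $\mathfrak{p}$ assigning a label $\mathfrak{p}(x,y)\in\mathcal{M}$ to each arc $(x,y)$, $1\le x<y\le n+1$; by convention the only $\mathcal{M}$-clique of arity $1$ is $\mathbf{u}$, with $\mathbf{u}(1,2)=\mathbb{1}_{\mathcal{M}}$. Write $\mathfrak{p}_0:=\mathfrak{p}(1,n+1)$ and $\mathfrak{p}_i:=\mathfrak{p}(i,i+1)$ for $i\in[n]$. $\mathsf{C}\mathcal{M}$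 is the operad (with unit $\mathbf{u}$) such that $\mathsf{C}\mathcal{M}(n)$ has basis the $\mathcal{M}$-cliques of arity $n$, and for $\mathcal{M}$-cliques $\mathfrak{p},\mathfrak{q}$ of arities $n,m$ and $i\in[n]$, $\mathfrak{p}\circ_i\mathfrak{q}$ is the $\mathcal{M}$-clique of arity $n+m-1$ with, for $1\le x<y\le n+m$, $$(\mathfrak{p}\circ_i\mathfrak{q})(x,y)=\begin{cases}\mathfrak{p}(x,y)&\text{if }y\le i,\\ \mathfrak{p}(x,y-m+1)&\text{if }x\le i<i+m\le y,\ (x,y)\ne(i,i+m),\\ \mathfrak{p}(x-m+1,y-m+1)&\text{if }i+m\le x,\\ \mathfrak{q}(x-i+1,y-i+1)&\text{if }i\le x<y\le i+m,\ (x,y)\ne(i,i+m),\\ \mathfrak{p}_i\star\mathfrak{q}_0&\text{if }(x,y)=(i,i+m),\\ \mathbb{1}_{\mathcal{M}}&\text{otherwise}.\end{cases}$$ A multi-tilde of arity $n\ge1$ is a pair $(n,\mathfrak{s})$ with $\mathfrak{s}\subseteq P_n:=\{(x,y)\in[n]^2:x\le y\}$. For multi-tildes $(n,\mathfrak{s})$, $(m,\mathfrak{u})$ and $i\in[n]$, let $$\mathfrak{s}\circ_i\mathfrak{u}:=\{\mathrm{sh}_i^m(x,y):(x,y)\in\mathfrak{s}\}\cup\{\mathrm{sh}_0^i(x,y):(x,y)\in\mathfrak{u}\}\subseteq P_{n+m-1},$$ where $\mathrm{sh}_j^p(x,y)=(x,y)$ if $y\le j-1$, $\mathrm{sh}_j^p(x,y)=(x,y+p-1)$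 if $x\le j\le y$, and $\mathrm{sh}_j^p(x,y)=(x+p-1,y+p-1)$ otherwise. A double multi-tilde of arity $n$ is a triple $(n,\mathfrak{s},\mathfrak{t})$ with $\mathfrak{s},\mathfrak{t}\subseteq P_n$. The operad $\mathsf{DMT}$ is the linear span of all double multi-tildes, graded by arity, with unit $(1,\emptyset,\emptyset)$ and $$(n,\mathfrak{s},\mathfrak{t})\circ_i(m,\mathfrak{u},\mathfrak{v})=(n+m-1,\ \mathfrak{s}\circ_i\mathfrak{u},\ \mathfrak{t}\circ_i\mathfrak{v}).$$ $\phi_{\mathsf{DMT}}$ is the linear map sending $(1,\emptyset,\emptyset)$ to the unit of $\mathsf{C}\mathbb{D}_0^2$ and each double multi-tilde $(n,\mathfrak{s},\mathfrak{t})$ with $n\ge2$ to the $\mathbb{D}_0^2$-clique of arity $n$ whose label at $(x,y)$, $1\le x<y\le n+1$, is $(a,b)$ with $a=0$ if $(x,y-1)\in\mathfrak{s}$ and $a=\mathbb{1}$ otherwise, $b=0$ if $(x,y-1)\in\mathfrak{t}$ and $b=\mathbb{1}$ otherwise. *)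

theory Defs
  imports Complex_Main "HOL-Algebra.Group" "HOL-Library.Poly_Mapping"
begin

section \<open>Nonsymmetric operads in vector spaces\<close>

text \<open>
  An operad is kept as one ambient vector space over \<open>'k\<close> with a family of homogeneous
  components. The partial composition \<open>pcomp P i\<close> is a total function whose values matter
  only on homogeneous elements.
\<close>

record ('k, 'v) ns_operad =
  scal      :: "'k \<Rightarrow> 'v \<Rightarrow> 'v"
  component :: "nat \<Rightarrow> 'v set"
  pcomp     :: "nat \<Rightarrow> 'v \<Rightarrow> 'v \<Rightarrow> 'v"
  op_unit   :: "'v"

locale ns_operad =
  fixes P :: "('k::field, 'v::ab_group_add) ns_operad"
  assumes vector_space: "vector_space (scal P)"
    and subspace_component: "module.subspace (scal P) (component P n)"
    and component_0: "component P 0 = {0}"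
    and components_independent:
      "component P n \<inter> module.span (scal P) (\<Union>m\<in>- {n}. component P m) = {0}"
    and unit_in_component: "op_unit P \<in> component P 1"
    and pcomp_in_component:
      "\<lbrakk>x \<in> component P n; y \<in> component P m; i \<in> {1..n}\<rbrakk>
        \<Longrightarrow> pcomp P i x y \<in> component P (n + m - 1)"
    and pcomp_add_left:
      "\<lbrakk>x \<in> component P n; x' \<in> component P n; y \<in> component P m; i \<in> {1..n}\<rbrakk>
        \<Longrightarrow> pcomp P i (x + x') y = pcomp P i x y + pcomp P i x' y"
    and pcomp_add_right:
      "\<lbrakk>x \<in> component P n; y \<in> component P m; y' \<in> component P m; i \<in> {1..n}\<rbrakk>
        \<Longrightarrow> pcomp P i x (y + y') = pcomp P i x y + pcomp P i x y'"
    and pcomp_scal_left: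
      "\<lbrakk>x \<in> component P n; y \<in> component P m; i \<in> {1..n}\<rbrakk>
        \<Longrightarrow> pcomp P i (scal P c x) y = scal P c (pcomp P i x y)"
    and pcomp_scal_right:
      "\<lbrakk>x \<in> component P n; y \<in> component P m; i \<in> {1..n}\<rbrakk>
        \<Longrightarrow> pcomp P i x (scal P c y) = scal P c (pcomp P i x y)"
    and pcomp_assoc_sequential:
      "\<lbrakk>x \<in> component P n; y \<in> component P m; z \<in> component P k; i \<in> {1..n}; j \<in> {1..m}\<rbrakk>
        \<Longrightarrow> pcomp P (i + j - 1) (pcomp P i x y) z = pcomp P i x (pcomp P j y z)"
    and pcomp_assoc_parallel:
      "\<lbrakk>x \<in> component P n; y \<in> component P m; z \<in> component P k; 1 \<le> i; i < j; j \<le> n\<rbrakk>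
        \<Longrightarrow> pcomp P (j + m - 1) (pcomp P i x y) z = pcomp P i (pcomp P j x z) y"
    and pcomp_unit_left: "x \<in> component P n \<Longrightarrow> pcomp P 1 (op_unit P) x = x"
    and pcomp_unit_right: "\<lbrakk>x \<in> component P n; i \<in> {1..n}\<rbrakk> \<Longrightarrow> pcomp P i x (op_unit P) = x"

definition op_space :: "('k::field, 'v::ab_group_add) ns_operad \<Rightarrow> 'v set" where
  "op_space P = module.span (scal P) (\<Union>n. component P n)"

definition suboperad ::
    "('k::field, 'v::ab_group_add) ns_operad \<Rightarrow> ('k, 'v) ns_operad \<Rightarrow> bool" where
  "suboperad Q P \<longleftrightarrow> ns_operad Q \<and> ns_operad P \<and>
     (\<forall>n. component Q n \<subseteq> component P n) \<and>
     scal Q = scal P \<and> pcomp Q = pcomp P \<and> op_unit Q = op_unit P"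

definition operad_hom ::
    "('v \<Rightarrow> 'w) \<Rightarrow> ('k::field, 'v::ab_group_add) ns_operad \<Rightarrow> ('k, 'w::ab_group_add) ns_operad
      \<Rightarrow> bool" where
  "operad_hom f P Q \<longleftrightarrow> ns_operad P \<and> ns_operad Q \<and>
     (\<forall>x\<in>op_space P. \<forall>y\<in>op_space P. f (x + y) = f x + f y) \<and>
     (\<forall>c. \<forall>x\<in>op_space P. f (scal P c x) = scal Q c (f x)) \<and>
     (\<forall>n. \<forall>x\<in>component P n. f x \<in> component Q n) \<and>
     f (op_unit P) = op_unit Q \<and>
     (\<forall>n m. \<forall>x\<in>component P n. \<forall>y\<in>component P m. \<forall>i\<in>{1..n}.
        f (pcomp P i x y) = pcomp Q i (f x) (f y))"

definition operad_iso ::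
    "('v \<Rightarrow> 'w) \<Rightarrow> ('k::field, 'v::ab_group_add) ns_operad \<Rightarrow> ('k, 'w::ab_group_add) ns_operad
      \<Rightarrow> bool" where
  "operad_iso f P Q \<longleftrightarrow> operad_hom f P Q \<and> bij_betw f (op_space P) (op_space Q)"

definition operads_isomorphic ::
    "('k::field, 'v::ab_group_add) ns_operad \<Rightarrow> ('k, 'w::ab_group_add) ns_operad \<Rightarrow> bool" where
  "operads_isomorphic P Q \<longleftrightarrow> (\<exists>f. operad_iso f P Q)"


section \<open>Free vector spaces\<close>

text \<open>
  Formal linear combinations of elements of \<open>'b\<close> are finitely supported functions
  \<open>'b \<Rightarrow>\<^sub>0 'k\<close>; the basis vector of \<open>b\<close> is \<open>single b 1\<close>.
\<close>

definition smult_pm :: "'k::field \<Rightarrow> ('b \<Rightarrow>\<^sub>0 'k) \<Rightarrow> ('b \<Rightarrow>\<^sub>0 'k)" where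
  "smult_pm c v = Poly_Mapping.map (\<lambda>a. c * a) v"

definition basis_vec :: "'b \<Rightarrow> ('b \<Rightarrow>\<^sub>0 'k::field)" where
  "basis_vec b = Poly_Mapping.single b 1"

definition lin_span :: "'b set \<Rightarrow> ('b \<Rightarrow>\<^sub>0 'k::field) set" where
  "lin_span B = module.span smult_pm (basis_vec ` B)"

definition lin_ext :: "('b \<Rightarrow> 'c) \<Rightarrow> ('b \<Rightarrow>\<^sub>0 'k::field) \<Rightarrow> ('c \<Rightarrow>\<^sub>0 'k)" where
  "lin_ext f v = (\<Sum>b\<in>Poly_Mapping.keys v. smult_pm (Poly_Mapping.lookup v b) (basis_vec (f b)))"

definition bilin_ext ::
    "('b \<Rightarrow> 'c \<Rightarrow> 'd) \<Rightarrow> ('b \<Rightarrow>\<^sub>0 'k::field) \<Rightarrow> ('c \<Rightarrow>\<^sub>0 'k) \<Rightarrow> ('d \<Rightarrow>\<^sub>0 'k)" where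
  "bilin_ext f v w = (\<Sum>b\<in>Poly_Mapping.keys v. \<Sum>c\<in>Poly_Mapping.keys w.
     smult_pm (Poly_Mapping.lookup v b * Poly_Mapping.lookup w c) (basis_vec (f b c)))"

lemma lookup_smult_pm [simp]:
  "Poly_Mapping.lookup (smult_pm c v) b = c * Poly_Mapping.lookup v b"
  by (simp add: smult_pm_def Poly_Mapping.map.rep_eq when_def)

lemma vector_space_smult_pm: "vector_space (smult_pm :: 'k::field \<Rightarrow> ('b \<Rightarrow>\<^sub>0 'k) \<Rightarrow> _)"
  by unfold_locales (auto intro!: poly_mapping_eqI simp: lookup_add algebra_simps)


section \<open>Unitary magmas\<close>

locale unitary_magma =
  fixes M :: "('a, 'b) monoid_scheme" (structure)
  assumes m_closed: "\<lbrakk>x \<in> carrier M; y \<in> carrier M\<rbrakk> \<Longrightarrow> x \<otimes> y \<in> carrier M"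
    and one_closed: "\<one> \<in> carrier M"
    and l_one: "x \<in> carrier M \<Longrightarrow> \<one> \<otimes> x = x"
    and r_one: "x \<in> carrier M \<Longrightarrow> x \<otimes> \<one> = x"

datatype d0 = D0_one | D0_zero

fun d0_mult :: "d0 \<Rightarrow> d0 \<Rightarrow> d0" where
  "d0_mult D0_one y = y"
| "d0_mult D0_zero y = D0_zero"

definition D0 :: "d0 monoid" where
  "D0 = \<lparr>carrier = UNIV, mult = d0_mult, one = D0_one\<rparr>"

definition D0_sq :: "(d0 \<times> d0) monoid" where
  "D0_sq = D0 \<times>\<times> D0"

lemma d0_mult_one_right [simp]: "d0_mult x D0_one = x"
  by (cases x) auto

lemma unitary_magma_D0: "unitary_magma D0"
  by unfold_locales (auto simp: D0_def)

lemma unitary_magma_D0_sq: "unitary_magma D0_sq"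
  by unfold_locales (auto simp: D0_sq_def D0_def DirProd_def)


section \<open>The operad of cliques on a unitary magma\<close>

text \<open>
  A clique is its arity together with its labelling, extensional (that is, \<open>undefined\<close>)
  outside the arcs, so that equal cliques are equal as HOL values.
\<close>

type_synonym 'a clique = "nat \<times> (nat \<times> nat \<Rightarrow> 'a)"

definition arcs :: "nat \<Rightarrow> (nat \<times> nat) set" where
  "arcs n = {(x, y). 1 \<le> x \<and> x < y \<and> y \<le> n + 1}"

definition cliques :: "('a, 'b) monoid_scheme \<Rightarrow> nat \<Rightarrow> 'a clique set" where
  "cliques M n = {(n, p) | p. 1 \<le> n \<and> p \<in> arcs n \<rightarrow>\<^sub>E carrier M \<and>
                              (n = 1 \<longrightarrow> p (1, 2) = \<one>\<^bsub>M\<^esub>)}"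

definition clique_unit :: "('a, 'b) monoid_scheme \<Rightarrow> 'a clique" where
  "clique_unit M = (1, restrict (\<lambda>_. \<one>\<^bsub>M\<^esub>) (arcs 1))"

fun clique_comp :: "('a, 'b) monoid_scheme \<Rightarrow> nat \<Rightarrow> 'a clique \<Rightarrow> 'a clique \<Rightarrow> 'a clique" where
  "clique_comp M i (n, p) (m, q) =
    (n + m - 1,
     restrict (\<lambda>(x, y).
       if y \<le> i then p (x, y)
       else if x \<le> i \<and> i + m \<le> y \<and> (x, y) \<noteq> (i, i + m) then p (x, y - m + 1)
       else if i + m \<le> x then p (x - m + 1, y - m + 1)
       else if i \<le> x \<and> y \<le> i + m \<and> (x, y) \<noteq> (i, i + m) then q (x - i + 1, y - i + 1)
       else if (x, y) = (i, i + m) then p (i, i + 1) \<otimes>\<^bsub>M\<^esub> q (1, m + 1)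
       else \<one>\<^bsub>M\<^esub>) (arcs (n + m - 1)))"

definition clique_operad ::
    "('a, 'b) monoid_scheme \<Rightarrow> ('k::field, 'a clique \<Rightarrow>\<^sub>0 'k) ns_operad" where
  "clique_operad M =
    \<lparr>scal = smult_pm,
     component = (\<lambda>n. lin_span (cliques M n)),
     pcomp = (\<lambda>i. bilin_ext (clique_comp M i)),
     op_unit = basis_vec (clique_unit M)\<rparr>"


section \<open>The operad of double multi-tildes\<close>

type_synonym tilde_set = "(nat \<times> nat) set"

type_synonym dmt = "nat \<times> tilde_set \<times> tilde_set"

definition tilde_pairs :: "nat \<Rightarrow> tilde_set" where
  "tilde_pairs n = {(x, y). 1 \<le> x \<and> x \<le> y \<and> y \<le> n}"

text \<open>The condition \<open>y \<le> j - 1\<close> over the integers is written \<open>y < j\<close>.\<close>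

fun sh :: "nat \<Rightarrow> nat \<Rightarrow> nat \<times> nat \<Rightarrow> nat \<times> nat" where
  "sh j p (x, y) =
    (if y < j then (x, y)
     else if x \<le> j \<and> j \<le> y then (x, y + p - 1)
     else (x + p - 1, y + p - 1))"

definition tilde_comp :: "nat \<Rightarrow> nat \<Rightarrow> tilde_set \<Rightarrow> tilde_set \<Rightarrow> tilde_set" where
  "tilde_comp m i s u = sh i m ` s \<union> sh 0 i ` u"

definition dmts :: "nat \<Rightarrow> dmt set" where
  "dmts n = {(n, s, t) | s t. 1 \<le> n \<and> s \<subseteq> tilde_pairs n \<and> t \<subseteq> tilde_pairs n}"

definition dmt_unit :: dmt where
  "dmt_unit = (1, {}, {})"

fun dmt_comp :: "nat \<Rightarrow> dmt \<Rightarrow> dmt \<Rightarrow> dmt" where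
  "dmt_comp i (n, s, t) (m, u, v) = (n + m - 1, tilde_comp m i s u, tilde_comp m i t v)"

definition DMT :: "('k::field, dmt \<Rightarrow>\<^sub>0 'k) ns_operad" where
  "DMT =
    \<lparr>scal = smult_pm,
     component = (\<lambda>n. lin_span (dmts n)),
     pcomp = (\<lambda>i. bilin_ext (dmt_comp i)),
     op_unit = basis_vec dmt_unit\<rparr>"

definition DMT_reduced :: "('k::field, dmt \<Rightarrow>\<^sub>0 'k) ns_operad" where
  "DMT_reduced = DMT\<lparr>component := (\<lambda>n. lin_span (dmts n - (dmts 1 - {dmt_unit})))\<rparr>"

text \<open>
  On \<open>dmt_unit\<close> the formula below yields the unit clique. Its values on the other double
  multi-tildes of arity 1 lie outside the domain of interest.
\<close>

fun dmt_clique :: "dmt \<Rightarrow> (d0 \<times> d0) clique" where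
  "dmt_clique (n, s, t) =
    (n, restrict (\<lambda>(x, y).
          (if (x, y - 1) \<in> s then D0_zero else D0_one,
           if (x, y - 1) \<in> t then D0_zero else D0_one)) (arcs n))"

definition phi_DMT :: "(dmt \<Rightarrow>\<^sub>0 'k::field) \<Rightarrow> ((d0 \<times> d0) clique \<Rightarrow>\<^sub>0 'k)" where
  "phi_DMT = lin_ext dmt_clique"

lemma dmt_clique_unit: "dmt_clique dmt_unit = clique_unit D0_sq"
  by (auto simp: dmt_unit_def clique_unit_def D0_sq_def D0_def DirProd_def)

lemma card_dmts_excluded: "card (dmts 1 - {dmt_unit}) = 3"
proof -
  have "tilde_pairs 1 = {(1, 1)}"
    by (auto simp: tilde_pairs_def)
  then have "dmts 1 - {dmt_unit} = {(1, {(1, 1)}, {}), (1, {}, {(1, 1)}), (1, {(1, 1)}, {(1, 1)})}"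
    by (auto simp: dmts_def dmt_unit_def subset_singleton_iff)
  then show ?thesis
    by simp
qed

end

theory Submission
  imports Defs
begin

text \<open>
  Both operads are linearizations of operads in sets: the partial compositions send pairs of
  basis elements to basis elements. It therefore suffices to work with the bases, and the linear
  statements follow from general facts on linear extensions (\<open>ns_operad_linearize\<close>,
  \<open>operad_iso_lin_ext\<close>).

  At the level of bases, a double multi-tilde is the pair of sets of arcs at which the two
  components of a clique labelling are \<open>0\<close>, the pair \<open>(x, y)\<close> standing for the arc
  \<open>(x, y + 1)\<close>. Since there are only two values, the zero sets determine the labelling and are
  arbitrary; in arity 1, however, the only clique is the unit, which is why three double
  multi-tildes are excluded. This gives the bijection \<open>bij_betw_dmt_clique\<close>. A composite of
  multi-tildes is a union of two shifted sets. The shifted sets meet at most in the pair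
  \<open>(i, i + m - 1)\<close>, that is, on the arc along which the two cliques are glued; there the union
  corresponds to the product of the labels, since a product of elements of \<open>{1, 0}\<close> is \<open>0\<close>
  exactly when one factor is. Hence the bijection is compatible with the compositions
  (\<open>dmt_clique_comp\<close>).

  The operad axioms for double multi-tildes reduce to identities between composites of shifts, and
  the axioms for cliques are transported along the bijection (\<open>set_operad_transport\<close>).
\<close>

section \<open>Linear extensions\<close>

interpretation pm: vector_space "smult_pm :: 'k::field \<Rightarrow> ('b \<Rightarrow>\<^sub>0 'k) \<Rightarrow> _"
  by (rule vector_space_smult_pm)

interpretation pm_pair: vector_space_pair
    "smult_pm :: 'k::field \<Rightarrow> ('b \<Rightarrow>\<^sub>0 'k) \<Rightarrow> _" "smult_pm :: 'k \<Rightarrow> ('c \<Rightarrow>\<^sub>0 'k) \<Rightarrow> _"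
  by (simp add: vector_space_pair_def vector_space_smult_pm)

lemma linear_smult_pmI:
  fixes f :: "('b \<Rightarrow>\<^sub>0 'k::field) \<Rightarrow> ('c \<Rightarrow>\<^sub>0 'k)"
  assumes "\<And>v w. f (v + w) = f v + f w" "\<And>a v. f (smult_pm a v) = smult_pm a (f v)"
  shows "Vector_Spaces.linear smult_pm smult_pm f"
  using assms by (auto simp: Vector_Spaces.linear_iff vector_space_smult_pm)

lemma poly_mapping_eq_sum_basis_vec:
  fixes v :: "'b \<Rightarrow>\<^sub>0 'k::field"
  shows "v = (\<Sum>b\<in>Poly_Mapping.keys v. smult_pm (Poly_Mapping.lookup v b) (basis_vec b))"
  by (rule poly_mapping_eqI)
     (auto simp: lookup_sum basis_vec_def lookup_single when_def in_keys_iff sum.delta' if_distrib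
           cong: if_cong)

lemma keys_smult_pm_subset: "Poly_Mapping.keys (smult_pm a v) \<subseteq> Poly_Mapping.keys v"
  by (auto simp: in_keys_iff)

lemma subspace_keys_subset:
  "pm.subspace {v :: 'b \<Rightarrow>\<^sub>0 'k::field. Poly_Mapping.keys v \<subseteq> B}"
proof (rule pm.subspaceI)
  show "0 \<in> {v :: 'b \<Rightarrow>\<^sub>0 'k. Poly_Mapping.keys v \<subseteq> B}"
    by simp
  show "v + w \<in> {v. Poly_Mapping.keys v \<subseteq> B}"
    if "v \<in> {v. Poly_Mapping.keys v \<subseteq> B}" "w \<in> {v. Poly_Mapping.keys v \<subseteq> B}" for v w :: "'b \<Rightarrow>\<^sub>0 'k"
    using that Poly_Mapping.keys_add[of v w] by auto
  show "smult_pm a v \<in> {v. Poly_Mapping.keys v \<subseteq> B}"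
    if "v \<in> {v. Poly_Mapping.keys v \<subseteq> B}" for a and v :: "'b \<Rightarrow>\<^sub>0 'k"
    using that keys_smult_pm_subset[of a v] by auto
qed

lemma lin_span_eq_keys:
  "lin_span B = {v :: 'b \<Rightarrow>\<^sub>0 'k::field. Poly_Mapping.keys v \<subseteq> B}"
proof
  show "lin_span B \<subseteq> {v :: 'b \<Rightarrow>\<^sub>0 'k. Poly_Mapping.keys v \<subseteq> B}"
    unfolding lin_span_def
  proof (rule pm.span_minimal)
    show "basis_vec ` B \<subseteq> {v :: 'b \<Rightarrow>\<^sub>0 'k. Poly_Mapping.keys v \<subseteq> B}"
      by (auto simp: basis_vec_def)
    show "pm.subspace {v :: 'b \<Rightarrow>\<^sub>0 'k. Poly_Mapping.keys v \<subseteq> B}"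
      by (rule subspace_keys_subset)
  qed
next
  show "{v :: 'b \<Rightarrow>\<^sub>0 'k. Poly_Mapping.keys v \<subseteq> B} \<subseteq> lin_span B"
  proof clarify
    fix v :: "'b \<Rightarrow>\<^sub>0 'k" assume "Poly_Mapping.keys v \<subseteq> B"
    then have "(\<Sum>b\<in>Poly_Mapping.keys v. smult_pm (Poly_Mapping.lookup v b) (basis_vec b)) \<in> lin_span B"
      unfolding lin_span_def by (intro pm.span_sum pm.span_scale pm.span_base) auto
    then show "v \<in> lin_span B"
      using poly_mapping_eq_sum_basis_vec[of v] by simp
  qed
qed

lemma basis_vec_in_lin_span: "b \<in> B \<Longrightarrow> basis_vec b \<in> lin_span B"
  unfolding lin_span_def by (intro pm.span_base) auto

lemma span_UN_lin_span:
  "pm.span (\<Union>n\<in>I. lin_span (B n)) = (lin_span (\<Union>n\<in>I. B n) :: ('b \<Rightarrow>\<^sub>0 'k::field) set)"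
proof
  show "pm.span (\<Union>n\<in>I. lin_span (B n)) \<subseteq> (lin_span (\<Union>n\<in>I. B n) :: ('b \<Rightarrow>\<^sub>0 'k) set)"
    by (rule pm.span_minimal) (auto simp: lin_span_eq_keys subspace_keys_subset)
  show "lin_span (\<Union>n\<in>I. B n) \<subseteq> (pm.span (\<Union>n\<in>I. lin_span (B n)) :: ('b \<Rightarrow>\<^sub>0 'k) set)"
    unfolding lin_span_def[of "\<Union>n\<in>I. B n"]
    by (rule pm.span_mono) (auto intro: basis_vec_in_lin_span)
qed

lemma linear_eq_on_lin_span:
  fixes f g :: "('b \<Rightarrow>\<^sub>0 'k::field) \<Rightarrow> ('c \<Rightarrow>\<^sub>0 'k)"
  assumes "x \<in> lin_span B"
    and "Vector_Spaces.linear smult_pm smult_pm f" "Vector_Spaces.linear smult_pm smult_pm g"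
    and "\<And>b. b \<in> B \<Longrightarrow> f (basis_vec b) = g (basis_vec b)"
  shows "f x = g x"
  by (rule pm_pair.linear_eq_on[OF assms(2,3) assms(1)[unfolded lin_span_def]]) (use assms(4) in auto)

lemma linear_image_lin_span:
  fixes f :: "('b \<Rightarrow>\<^sub>0 'k::field) \<Rightarrow> ('c \<Rightarrow>\<^sub>0 'k)"
  assumes "x \<in> lin_span B"
    and "Vector_Spaces.linear smult_pm smult_pm f"
    and "\<And>b. b \<in> B \<Longrightarrow> f (basis_vec b) \<in> lin_span C"
  shows "f x \<in> lin_span C"
proof -
  have "f x \<in> f ` pm.span (basis_vec ` B)"
    using assms(1) by (simp add: lin_span_def)
  also have "\<dots> = pm.span (f ` basis_vec ` B)"
    by (rule pm_pair.linear_span_image[OF assms(2), symmetric])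
  also have "\<dots> \<subseteq> lin_span C"
    using assms(3) by (intro pm.span_minimal) (auto simp: lin_span_def)
  finally show ?thesis .
qed

lemma bilin_ext_superset:
  fixes v :: "'b \<Rightarrow>\<^sub>0 'k::field"
  assumes "finite A" "Poly_Mapping.keys v \<subseteq> A" "finite C" "Poly_Mapping.keys w \<subseteq> C"
  shows "bilin_ext f v w = (\<Sum>b\<in>A. \<Sum>c\<in>C.
    smult_pm (Poly_Mapping.lookup v b * Poly_Mapping.lookup w c) (basis_vec (f b c)))"
  unfolding bilin_ext_def using assms
  by (intro sum.mono_neutral_cong_left sum.neutral ballI sum.mono_neutral_left)
     (auto simp: in_keys_iff)

lemma linear_bilin_ext_left:
  fixes f :: "'b \<Rightarrow> 'c \<Rightarrow> 'd" and w :: "'c \<Rightarrow>\<^sub>0 'k::field"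
  shows "Vector_Spaces.linear smult_pm smult_pm (\<lambda>v. bilin_ext f v w)"
proof (rule linear_smult_pmI)
  fix v v' :: "'b \<Rightarrow>\<^sub>0 'k" and a :: 'k
  let ?A = "Poly_Mapping.keys v \<union> Poly_Mapping.keys v'" and ?C = "Poly_Mapping.keys w"
  show "bilin_ext f (v + v') w = bilin_ext f v w + bilin_ext f v' w"
    using Poly_Mapping.keys_add[of v v']
    by (simp add: bilin_ext_superset[of ?A _ ?C] lookup_add distrib_right
        pm.scale_left_distrib sum.distrib)
  show "bilin_ext f (smult_pm a v) w = smult_pm a (bilin_ext f v w)"
    using keys_smult_pm_subset[of a v]
    by (simp add: bilin_ext_superset[of "Poly_Mapping.keys v" _ ?C] pm.scale_sum_right mult.assoc)
qed

lemma linear_bilin_ext_right: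
  fixes f :: "'b \<Rightarrow> 'c \<Rightarrow> 'd" and v :: "'b \<Rightarrow>\<^sub>0 'k::field"
  shows "Vector_Spaces.linear smult_pm smult_pm (bilin_ext f v)"
proof (rule linear_smult_pmI)
  fix w w' :: "'c \<Rightarrow>\<^sub>0 'k" and a :: 'k
  let ?A = "Poly_Mapping.keys w \<union> Poly_Mapping.keys w'" and ?C = "Poly_Mapping.keys v"
  show "bilin_ext f v (w + w') = bilin_ext f v w + bilin_ext f v w'"
    using Poly_Mapping.keys_add[of w w']
    by (simp add: bilin_ext_superset[of ?C _ ?A] lookup_add distrib_left
        pm.scale_left_distrib sum.distrib)
  show "bilin_ext f v (smult_pm a w) = smult_pm a (bilin_ext f v w)"
    using keys_smult_pm_subset[of a w]
    by (simp add: bilin_ext_superset[of ?C _ "Poly_Mapping.keys w"] pm.scale_sum_right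
        mult.left_commute)
qed

lemma bilin_ext_basis_vec:
  "bilin_ext f (basis_vec b) (basis_vec c) = (basis_vec (f b c) :: 'd \<Rightarrow>\<^sub>0 'k::field)"
  by (simp add: bilin_ext_def basis_vec_def pm.scale_one)

lemma linear_lin_ext:
  fixes f :: "'b \<Rightarrow> 'c"
  shows "Vector_Spaces.linear smult_pm smult_pm (lin_ext f :: ('b \<Rightarrow>\<^sub>0 'k::field) \<Rightarrow> _)"
proof -
  have superset: "lin_ext f v = (\<Sum>b\<in>A. smult_pm (Poly_Mapping.lookup v b) (basis_vec (f b)))"
    if "finite A" "Poly_Mapping.keys v \<subseteq> A" for A and v :: "'b \<Rightarrow>\<^sub>0 'k"
    unfolding lin_ext_def using that by (intro sum.mono_neutral_left) (auto simp: in_keys_iff)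
  show ?thesis
  proof (rule linear_smult_pmI)
    fix v v' :: "'b \<Rightarrow>\<^sub>0 'k" and a :: 'k
    show "lin_ext f (v + v') = lin_ext f v + lin_ext f v'"
      using Poly_Mapping.keys_add[of v v']
      by (simp add: superset[of "Poly_Mapping.keys v \<union> Poly_Mapping.keys v'"] lookup_add
          pm.scale_left_distrib sum.distrib)
    show "lin_ext f (smult_pm a v) = smult_pm a (lin_ext f v)"
      using keys_smult_pm_subset[of a v]
      by (simp add: superset[of "Poly_Mapping.keys v"] pm.scale_sum_right)
  qed
qed

lemma lin_ext_basis_vec: "lin_ext f (basis_vec b) = (basis_vec (f b) :: 'c \<Rightarrow>\<^sub>0 'k::field)"
  by (simp add: lin_ext_def basis_vec_def pm.scale_one)

lemmas bilin_ext_linear_simps =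
  pm_pair.linear_add[OF linear_bilin_ext_left] pm_pair.linear_add[OF linear_bilin_ext_right]
  pm_pair.linear_scale[OF linear_bilin_ext_left] pm_pair.linear_scale[OF linear_bilin_ext_right]

lemma linear_comp:
  assumes "Vector_Spaces.linear smult_pm smult_pm f" "Vector_Spaces.linear smult_pm smult_pm g"
  shows "Vector_Spaces.linear smult_pm smult_pm (\<lambda>x. f (g x))"
  using Vector_Spaces.linear_compose[OF assms(2,1)] by (simp add: comp_def)

lemmas linear_intros = linear_comp[OF linear_bilin_ext_left] linear_comp[OF linear_bilin_ext_right]
  linear_comp[OF linear_lin_ext] linear_bilin_ext_left linear_bilin_ext_right
  linear_lin_ext pm.linear_ident


section \<open>Operads in sets and their linearizations\<close>

text \<open>
  A nonsymmetric operad in the category of sets: \<open>B n\<close> is the set of elements of arity \<open>n\<close>.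
  The compositions are total functions whose values matter only on elements with a valid index.
\<close>

locale set_operad =
  fixes B :: "nat \<Rightarrow> 'b set" and c :: "nat \<Rightarrow> 'b \<Rightarrow> 'b \<Rightarrow> 'b" and u :: 'b
  assumes arity_0: "B 0 = {}"
    and arity_unique: "\<lbrakk>x \<in> B n; x \<in> B m\<rbrakk> \<Longrightarrow> n = m"
    and unit_in: "u \<in> B 1"
    and comp_in: "\<lbrakk>x \<in> B n; y \<in> B m; i \<in> {1..n}\<rbrakk> \<Longrightarrow> c i x y \<in> B (n + m - 1)"
    and assoc_sequential:
      "\<lbrakk>x \<in> B n; y \<in> B m; z \<in> B k; i \<in> {1..n}; j \<in> {1..m}\<rbrakk>
        \<Longrightarrow> c (i + j - 1) (c i x y) z = c i x (c j y z)"
    and assoc_parallel: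
      "\<lbrakk>x \<in> B n; y \<in> B m; z \<in> B k; 1 \<le> i; i < j; j \<le> n\<rbrakk>
        \<Longrightarrow> c (j + m - 1) (c i x y) z = c i (c j x z) y"
    and unit_left: "x \<in> B n \<Longrightarrow> c 1 u x = x"
    and unit_right: "\<lbrakk>x \<in> B n; i \<in> {1..n}\<rbrakk> \<Longrightarrow> c i x u = x"

text \<open>
  The operad of formal linear combinations of the elements of \<open>B\<close>, with the partial compositions
  extended bilinearly.
\<close>

definition linearize ::
    "(nat \<Rightarrow> 'b set) \<Rightarrow> (nat \<Rightarrow> 'b \<Rightarrow> 'b \<Rightarrow> 'b) \<Rightarrow> 'b \<Rightarrow> ('k::field, 'b \<Rightarrow>\<^sub>0 'k) ns_operad" where
  "linearize B c u =
    \<lparr>scal = smult_pm, component = (\<lambda>n. lin_span (B n)), pcomp = (\<lambda>i. bilin_ext (c i)),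
     op_unit = basis_vec u\<rparr>"

lemma op_space_linearize: "op_space (linearize B c u) = lin_span (\<Union>n. B n)"
  by (simp add: op_space_def linearize_def span_UN_lin_span)

lemma bilin_ext_in_lin_span:
  assumes "x \<in> lin_span A" "y \<in> lin_span C" "\<And>a b. a \<in> A \<Longrightarrow> b \<in> C \<Longrightarrow> f a b \<in> D"
  shows "bilin_ext f x y \<in> lin_span D"
  by (rule linear_image_lin_span[OF assms(1) linear_bilin_ext_left],
      rule linear_image_lin_span[OF assms(2) linear_bilin_ext_right])
     (simp add: bilin_ext_basis_vec basis_vec_in_lin_span assms(3))

text \<open>
  The axioms that involve several elements are equalities between multilinear maps, so they need
  only be verified on basis vectors, one variable after the other.
\<close>

theorem ns_operad_linearize:
  assumes "set_operad B c u"
  shows "ns_operad (linearize B c u :: ('k::field, 'b \<Rightarrow>\<^sub>0 'k) ns_operad)"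
proof -
  interpret set_operad B c u by fact
  show ?thesis
  proof (rule ns_operad.intro, unfold linearize_def ns_operad.simps)
    show "vector_space (smult_pm :: 'k \<Rightarrow> ('b \<Rightarrow>\<^sub>0 'k) \<Rightarrow> _)"
      by (rule vector_space_smult_pm)
    show "pm.subspace (lin_span (B n) :: ('b \<Rightarrow>\<^sub>0 'k) set)" for n
      by (simp add: lin_span_def)
    show "lin_span (B 0) = {0 :: 'b \<Rightarrow>\<^sub>0 'k}"
      by (simp add: arity_0 lin_span_def)
    show "lin_span (B n) \<inter> pm.span (\<Union>m\<in>- {n}. lin_span (B m)) = {0 :: 'b \<Rightarrow>\<^sub>0 'k}" for n
    proof -
      have "B n \<inter> (\<Union>m\<in>- {n}. B m) = {}"
        using arity_unique by blast
      then have "x = 0" if "Poly_Mapping.keys x \<subseteq> B n" "Poly_Mapping.keys x \<subseteq> (\<Union>m\<in>- {n}. B m)"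
        for x :: "'b \<Rightarrow>\<^sub>0 'k"
        using that by (metis Int_subset_iff keys_eq_empty subset_empty)
      then show ?thesis
        unfolding span_UN_lin_span by (auto simp: lin_span_eq_keys)
    qed
    show "(basis_vec u :: 'b \<Rightarrow>\<^sub>0 'k) \<in> lin_span (B 1)"
      by (rule basis_vec_in_lin_span[OF unit_in])
  next
    fix x y :: "'b \<Rightarrow>\<^sub>0 'k" and n m i
    assume "x \<in> lin_span (B n)" "y \<in> lin_span (B m)" and i: "i \<in> {1..n}"
    then show "bilin_ext (c i) x y \<in> lin_span (B (n + m - 1))"
      using comp_in[OF _ _ i] by (blast intro: bilin_ext_in_lin_span)
  next
    fix x y z :: "'b \<Rightarrow>\<^sub>0 'k" and n m k i j
    assume x: "x \<in> lin_span (B n)" and y: "y \<in> lin_span (B m)" and z: "z \<in> lin_span (B k)"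
      and ij: "i \<in> {1..n}" "j \<in> {1..m}"
    show "bilin_ext (c (i + j - 1)) (bilin_ext (c i) x y) z
        = bilin_ext (c i) x (bilin_ext (c j) y z)"
      by (rule linear_eq_on_lin_span[OF x], (rule linear_intros)+,
          rule linear_eq_on_lin_span[OF y], (rule linear_intros)+,
          rule linear_eq_on_lin_span[OF z], (rule linear_intros)+)
         (simp only: bilin_ext_basis_vec assoc_sequential[OF _ _ _ ij])
  next
    fix x y z :: "'b \<Rightarrow>\<^sub>0 'k" and n m k i j :: nat
    assume x: "x \<in> lin_span (B n)" and y: "y \<in> lin_span (B m)" and z: "z \<in> lin_span (B k)"
      and ij: "1 \<le> i" "i < j" "j \<le> n"
    show "bilin_ext (c (j + m - 1)) (bilin_ext (c i) x y) z
        = bilin_ext (c i) (bilin_ext (c j) x z) y"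
      by (rule linear_eq_on_lin_span[OF x], (rule linear_intros)+,
          rule linear_eq_on_lin_span[OF y], (rule linear_intros)+,
          rule linear_eq_on_lin_span[OF z], (rule linear_intros)+)
         (simp only: bilin_ext_basis_vec assoc_parallel[OF _ _ _ ij])
  next
    fix x :: "'b \<Rightarrow>\<^sub>0 'k" and n
    assume x: "x \<in> lin_span (B n)"
    show "bilin_ext (c 1) (basis_vec u) x = x"
      by (rule linear_eq_on_lin_span[OF x], (rule linear_intros)+)
         (simp only: bilin_ext_basis_vec unit_left)
  next
    fix x :: "'b \<Rightarrow>\<^sub>0 'k" and n i
    assume x: "x \<in> lin_span (B n)" and i: "i \<in> {1..n}"
    show "bilin_ext (c i) x (basis_vec u) = x"
      by (rule linear_eq_on_lin_span[OF x], (rule linear_intros)+)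
         (simp only: bilin_ext_basis_vec unit_right[OF _ i])
  qed (simp_all add: bilin_ext_linear_simps)
qed

text \<open>
  An isomorphism between operads in sets: a morphism that is bijective in each arity. Since arities
  are unique, it is a bijection between the sets of all elements.
\<close>

definition set_operad_iso where
  "set_operad_iso f B c u B' c' u' \<longleftrightarrow>
     set_operad B c u \<and> set_operad B' c' u' \<and>
     (\<forall>n. bij_betw f (B n) (B' n)) \<and> f u = u' \<and>
     (\<forall>n m. \<forall>x\<in>B n. \<forall>y\<in>B m. \<forall>i\<in>{1..n}. f (c i x y) = c' i (f x) (f y))"

lemma set_operad_iso_inverse:
  assumes iso: "set_operad_iso f B c u B' c' u'"
    and g: "\<And>n x. x \<in> B n \<Longrightarrow> g (f x) = x"
  shows "set_operad_iso g B' c' u' B c u"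
proof -
  have ops: "set_operad B c u" "set_operad B' c' u'" and bij: "\<And>n. bij_betw f (B n) (B' n)"
    and u: "f u = u'"
    and hom: "\<And>n m x y i. \<lbrakk>x \<in> B n; y \<in> B m; i \<in> {1..n}\<rbrakk> \<Longrightarrow> f (c i x y) = c' i (f x) (f y)"
    using iso by (auto simp: set_operad_iso_def)
  interpret src: set_operad B c u by fact
  have img: "f ` B n = B' n" for n
    using bij by (simp add: bij_betw_def)
  have "bij_betw g (B' n) (B n)" for n
    using bij g by (intro bij_betw_byWitness[where f' = f]) (auto simp flip: img)
  moreover have "g u' = u"
    using g src.unit_in u by blast
  moreover have "g (c' i x' y') = c i (g x') (g y')"
    if "x' \<in> B' n" "y' \<in> B' m" "i \<in> {1..n}" for n m x' y' i
  proof -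
    obtain x y where xy: "x \<in> B n" "y \<in> B m" "x' = f x" "y' = f y"
      using \<open>x' \<in> B' n\<close> \<open>y' \<in> B' m\<close> by (auto simp flip: img)
    then show ?thesis
      using g hom[OF xy(1,2) that(3)] src.comp_in[OF xy(1,2) that(3)] by metis
  qed
  ultimately show ?thesis
    using ops unfolding set_operad_iso_def by blast
qed

text \<open>Transport of the axioms along a bijective morphism to a family of disjoint sets.\<close>

lemma set_operad_transport:
  assumes "set_operad B c u"
    and bij: "\<And>n. bij_betw f (B n) (B' n)"
    and disjoint: "\<And>n m x. \<lbrakk>x \<in> B' n; x \<in> B' m\<rbrakk> \<Longrightarrow> n = m"
    and u: "f u = u'"
    and hom: "\<And>n m x y i. \<lbrakk>x \<in> B n; y \<in> B m; i \<in> {1..n}\<rbrakk> \<Longrightarrow> f (c i x y) = c' i (f x) (f y)"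
  shows "set_operad_iso f B c u B' c' u'"
proof -
  interpret set_operad B c u by fact
  have img: "B' n = f ` B n" for n
    using bij by (simp add: bij_betw_def)
  have "set_operad B' c' u'"
  proof
    show "B' 0 = {}"
      by (simp add: img arity_0)
    show "n = m" if "x \<in> B' n" "x \<in> B' m" for n m x
      using disjoint that .
    show "u' \<in> B' 1"
      using unit_in u by (auto simp: img)
  next
    fix x y n m i assume "x \<in> B' n" "y \<in> B' m" "i \<in> {1..n}"
    then show "c' i x y \<in> B' (n + m - 1)"
      using hom comp_in by (auto simp: img simp flip: hom)
  next
    fix x y z n m k i j assume "x \<in> B' n" "y \<in> B' m" "z \<in> B' k" and i: "i \<in> {1..n}" and j: "j \<in> {1..m}"
    then obtain x' y' z' where e: "x' \<in> B n" "y' \<in> B m" "z' \<in> B k" "x = f x'" "y = f y'" "z = f z'"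
      by (auto simp: img)
    have ij: "i + j - 1 \<in> {1..n + m - 1}"
      using i j by auto
    show "c' (i + j - 1) (c' i x y) z = c' i x (c' j y z)"
      using hom[OF e(1,2) i] hom[OF e(2,3) j] hom[OF comp_in[OF e(1,2) i] e(3) ij]
        hom[OF e(1) comp_in[OF e(2,3) j] i] assoc_sequential[OF e(1-3) i j] e(4-6) by simp
  next
    fix x y z n m k i j assume "x \<in> B' n" "y \<in> B' m" "z \<in> B' k" and ij: "1 \<le> i" "i < j" "j \<le> n"
    then obtain x' y' z' where e: "x' \<in> B n" "y' \<in> B m" "z' \<in> B k" "x = f x'" "y = f y'" "z = f z'"
      by (auto simp: img)
    have "k \<noteq> 0"
      using e(3) arity_0 by (cases k) auto
    then have mem: "i \<in> {1..n}" "j \<in> {1..n}" "j + m - 1 \<in> {1..n + m - 1}" "i \<in> {1..n + k - 1}"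
      using ij by auto
    show "c' (j + m - 1) (c' i x y) z = c' i (c' j x z) y"
      using hom[OF e(1,2) mem(1)] hom[OF e(1,3) mem(2)]
        hom[OF comp_in[OF e(1,2) mem(1)] e(3) mem(3)] hom[OF comp_in[OF e(1,3) mem(2)] e(2) mem(4)]
        assoc_parallel[OF e(1-3) ij] e(4-6) by simp
  next
    fix x n assume "x \<in> B' n"
    then obtain x' where x': "x' \<in> B n" "x = f x'" by (auto simp: img)
    have "c' 1 (f u) (f x') = f (c 1 u x')"
      by (rule hom[OF unit_in x'(1), symmetric]) simp
    then show "c' 1 u' x = x"
      using u x' unit_left by metis
  next
    fix x n i assume "x \<in> B' n" "i \<in> {1..n}"
    then show "c' i x u' = x"
      using unit_in unit_right by (auto simp: img simp flip: u hom)
  qed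
  then show ?thesis
    using assms unfolding set_operad_iso_def by blast
qed

lemma set_operad_sub:
  assumes "set_operad B c u" and "\<And>n. C n \<subseteq> B n" and "u \<in> C 1"
    and "\<And>x y n m i. \<lbrakk>x \<in> C n; y \<in> C m; i \<in> {1..n}\<rbrakk> \<Longrightarrow> c i x y \<in> C (n + m - 1)"
  shows "set_operad C c u"
proof -
  interpret set_operad B c u by fact
  note sub = subsetD[OF assms(2)]
  show ?thesis
    by unfold_locales
       (use assms arity_0 in blast, fact arity_unique[OF sub sub], fact assms(3), fact assms(4),
        fact assoc_sequential[OF sub sub sub], fact assoc_parallel[OF sub sub sub],
        fact unit_left[OF sub], fact unit_right[OF sub])
qed

theorem operad_iso_lin_ext:
  assumes iso: "set_operad_iso f B c u B' c' u'"
  shows "operad_iso (lin_ext f) (linearize B c u :: ('k::field, _) ns_operad) (linearize B' c' u')"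
proof -
  have ops: "set_operad B c u" "set_operad B' c' u'" and bij: "\<And>n. bij_betw f (B n) (B' n)"
    and u: "f u = u'"
    and hom: "\<And>n m x y i. \<lbrakk>x \<in> B n; y \<in> B m; i \<in> {1..n}\<rbrakk> \<Longrightarrow> f (c i x y) = c' i (f x) (f y)"
    using iso by (auto simp: set_operad_iso_def)
  interpret src: set_operad B c u by fact
  interpret tgt: set_operad B' c' u' by fact
  let ?F = "lin_ext f :: _ \<Rightarrow> _ \<Rightarrow>\<^sub>0 'k"
  have img: "f ` B n = B' n" for n
    using bij by (simp add: bij_betw_def)
  have image: "?F x \<in> lin_span (B' n)" if "x \<in> lin_span (B n)" for x n
    using that linear_lin_ext
    by (rule linear_image_lin_span) (auto simp: lin_ext_basis_vec simp flip: img intro: basis_vec_in_lin_span)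
  have comp: "?F (bilin_ext (c i) x y) = bilin_ext (c' i) (?F x) (?F y)"
    if x: "x \<in> lin_span (B n)" and y: "y \<in> lin_span (B m)" and i: "i \<in> {1..n}" for x y n m i
    by (rule linear_eq_on_lin_span[OF x], (rule linear_intros)+,
        rule linear_eq_on_lin_span[OF y], (rule linear_intros)+)
       (simp only: bilin_ext_basis_vec lin_ext_basis_vec hom[OF _ _ i])
  have hom_F: "operad_hom ?F (linearize B c u) (linearize B' c' u')"
    unfolding operad_hom_def
  proof (intro conjI)
    show "ns_operad (linearize B c u :: ('k, _) ns_operad)"
      and "ns_operad (linearize B' c' u' :: ('k, _) ns_operad)"
      using ops by (simp_all add: ns_operad_linearize)
  qed (use image comp in \<open>auto simp: linearize_def lin_ext_basis_vec u
      pm_pair.linear_add[OF linear_lin_ext] pm_pair.linear_scale[OF linear_lin_ext]\<close>)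
  have bij_UN: "bij_betw f (\<Union>n. B n) (\<Union>n. B' n)"
    unfolding bij_betw_def
  proof
    show "inj_on f (\<Union>n. B n)"
    proof (rule inj_onI, clarify)
      fix x y n m assume xy: "f x = f y" "x \<in> B n" "y \<in> B m"
      then have "f x \<in> B' n" "f x \<in> B' m"
        using img by (blast, metis imageI)
      then have "n = m"
        by (rule tgt.arity_unique)
      then show "x = y"
        using xy bij by (auto simp: bij_betw_def dest: inj_onD)
    qed
    show "f ` (\<Union>n. B n) = (\<Union>n. B' n)"
      by (simp add: image_UN img)
  qed
  define g where "g = inv_into (\<Union>n. B n) f"
  have g: "b \<in> (\<Union>n. B n) \<Longrightarrow> g (f b) = b" "b \<in> (\<Union>n. B n) \<Longrightarrow> f b \<in> (\<Union>n. B' n)"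
    "d \<in> (\<Union>n. B' n) \<Longrightarrow> f (g d) = d" "d \<in> (\<Union>n. B' n) \<Longrightarrow> g d \<in> (\<Union>n. B n)" for b d
    unfolding g_def by (fact bij_betw_inv_into_left[OF bij_UN] bij_betw_apply[OF bij_UN]
        bij_betw_inv_into_right[OF bij_UN] bij_betw_apply[OF bij_betw_inv_into[OF bij_UN]])+
  let ?G = "lin_ext g :: _ \<Rightarrow> _ \<Rightarrow>\<^sub>0 'k"
  have "bij_betw ?F (lin_span (\<Union>n. B n)) (lin_span (\<Union>n. B' n))"
  proof (rule bij_betw_byWitness[where f' = ?G])
    show "\<forall>x\<in>lin_span (\<Union>n. B n). ?G (?F x) = x"
    proof
      fix x :: "_ \<Rightarrow>\<^sub>0 'k" assume x: "x \<in> lin_span (\<Union>n. B n)"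
      show "?G (?F x) = x"
        by (rule linear_eq_on_lin_span[OF x], (rule linear_intros)+) (simp only: lin_ext_basis_vec g)
    qed
    show "\<forall>x\<in>lin_span (\<Union>n. B' n). ?F (?G x) = x"
    proof
      fix x :: "_ \<Rightarrow>\<^sub>0 'k" assume x: "x \<in> lin_span (\<Union>n. B' n)"
      show "?F (?G x) = x"
        by (rule linear_eq_on_lin_span[OF x], (rule linear_intros)+) (simp only: lin_ext_basis_vec g)
    qed
    show "?F ` lin_span (\<Union>n. B n) \<subseteq> lin_span (\<Union>n. B' n)"
    proof (rule image_subsetI)
      fix x :: "_ \<Rightarrow>\<^sub>0 'k" assume x: "x \<in> lin_span (\<Union>n. B n)"
      show "?F x \<in> lin_span (\<Union>n. B' n)"
        by (rule linear_image_lin_span[OF x linear_lin_ext])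
           (simp only: lin_ext_basis_vec g basis_vec_in_lin_span)
    qed
    show "?G ` lin_span (\<Union>n. B' n) \<subseteq> lin_span (\<Union>n. B n)"
    proof (rule image_subsetI)
      fix x :: "_ \<Rightarrow>\<^sub>0 'k" assume x: "x \<in> lin_span (\<Union>n. B' n)"
      show "?G x \<in> lin_span (\<Union>n. B n)"
        by (rule linear_image_lin_span[OF x linear_lin_ext])
           (simp only: lin_ext_basis_vec g basis_vec_in_lin_span)
    qed
  qed
  with hom_F show ?thesis
    by (simp add: operad_iso_def op_space_linearize)
qed


section \<open>Double multi-tildes\<close>

lemma tilde_pairs_iff: "(x, y) \<in> tilde_pairs n \<longleftrightarrow> 1 \<le> x \<and> x \<le> y \<and> y \<le> n"
  by (simp add: tilde_pairs_def)

lemma tilde_comp_subset: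
  assumes "s \<subseteq> tilde_pairs n" "u \<subseteq> tilde_pairs m" "i \<in> {1..n}" "1 \<le> m"
  shows "tilde_comp m i s u \<subseteq> tilde_pairs (n + m - 1)"
proof -
  have "sh i m p \<in> tilde_pairs (n + m - 1)" if "p \<in> tilde_pairs n" for p
    using that assms(3,4) by (cases p) (auto simp: tilde_pairs_iff)
  moreover have "sh 0 i p \<in> tilde_pairs (n + m - 1)" if "p \<in> tilde_pairs m" for p
    using that assms(3,4) by (cases p) (auto simp: tilde_pairs_iff)
  ultimately show ?thesis
    using assms(1,2) by (auto simp: tilde_comp_def)
qed

lemma tilde_comp_assoc_sequential:
  assumes s: "s \<subseteq> tilde_pairs n" and u: "u \<subseteq> tilde_pairs m" and v: "v \<subseteq> tilde_pairs k"
    and "i \<in> {1..n}" "j \<in> {1..m}" "1 \<le> k"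
  shows "tilde_comp k (i + j - 1) (tilde_comp m i s u) v
       = tilde_comp (m + k - 1) i s (tilde_comp k j u v)"
proof -
  \<comment> \<open>Writing the arities and the index as successors removes the truncated subtractions.\<close>
  obtain m' k' j' where mkj: "m = Suc m'" "k = Suc k'" "j = Suc j'"
    using assms(5,6) by (cases m; cases k; cases j) auto
  have 1: "sh (i + j - 1) k (sh i m p) = sh i (m + k - 1) p" if "p \<in> tilde_pairs n" for p
  proof -
    obtain x y where xy: "p = (x, y)"
      by (cases p)
    consider "y < i" | "x \<le> i" "i \<le> y" | "i < x" "i \<le> y"
      using that unfolding xy tilde_pairs_iff by linarith
    then show ?thesis
      using that assms(4,5) unfolding xy mkj tilde_pairs_iff by cases auto
  qed
  have 2: "sh (i + j - 1) k (sh 0 i p) = sh 0 i (sh j k p)" if "p \<in> tilde_pairs m" for p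
    using that assms(4-6) by (cases p) (auto simp: tilde_pairs_iff)
  have 3: "sh 0 (i + j - 1) p = sh 0 i (sh 0 j p)" if "p \<in> tilde_pairs k" for p
    using that assms(4-6) by (cases p) (auto simp: tilde_pairs_iff)
  have "(\<lambda>p. sh (i + j - 1) k (sh i m p)) ` s = sh i (m + k - 1) ` s"
    using s 1 by (intro image_cong) auto
  moreover have "(\<lambda>p. sh (i + j - 1) k (sh 0 i p)) ` u = (\<lambda>p. sh 0 i (sh j k p)) ` u"
    using u 2 by (intro image_cong) auto
  moreover have "sh 0 (i + j - 1) ` v = (\<lambda>p. sh 0 i (sh 0 j p)) ` v"
    using v 3 by (intro image_cong) auto
  ultimately show ?thesis
    by (simp add: tilde_comp_def image_Un image_image Un_assoc)
qed

lemma tilde_comp_assoc_parallel: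
  assumes s: "s \<subseteq> tilde_pairs n" and u: "u \<subseteq> tilde_pairs m" and v: "v \<subseteq> tilde_pairs k"
    and "1 \<le> i" "i < j" "j \<le> n" "1 \<le> m" "1 \<le> k"
  shows "tilde_comp k (j + m - 1) (tilde_comp m i s u) v
       = tilde_comp m i (tilde_comp k j s v) u"
proof -
  have 1: "sh (j + m - 1) k (sh i m p) = sh i m (sh j k p)" if "p \<in> tilde_pairs n" for p
  proof -
    obtain x y where xy: "p = (x, y)"
      by (cases p)
    then have p: "1 \<le> x" "x \<le> y"
      using that by (simp_all add: tilde_pairs_iff)
    obtain m' k' where mk: "m = Suc m'" "k = Suc k'"
      using \<open>1 \<le> m\<close> \<open>1 \<le> k\<close> by (metis One_nat_def Suc_le_D)
    consider "y < i" | "x \<le> i" "i \<le> y" "y < j" | "x \<le> i" "j \<le> y"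
      | "i < x" "y < j" | "i < x" "x \<le> j" "j \<le> y" | "j < x"
      using p assms(4,5) by linarith
    then show ?thesis
      unfolding xy mk using p assms(4,5) by cases simp_all
  qed
  have 2: "sh (j + m - 1) k (sh 0 i p) = sh 0 i p" if "p \<in> tilde_pairs m" for p
    using that assms(4-8) by (cases p) (auto simp: tilde_pairs_iff)
  have 3: "sh 0 (j + m - 1) p = sh i m (sh 0 j p)" if "p \<in> tilde_pairs k" for p
    using that assms(4-8) by (cases p) (auto simp: tilde_pairs_iff)
  have "(\<lambda>p. sh (j + m - 1) k (sh i m p)) ` s = (\<lambda>p. sh i m (sh j k p)) ` s"
    using s 1 by (intro image_cong) auto
  moreover have "(\<lambda>p. sh (j + m - 1) k (sh 0 i p)) ` u = sh 0 i ` u"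
    using u 2 by (intro image_cong) auto
  moreover have "sh 0 (j + m - 1) ` v = (\<lambda>p. sh i m (sh 0 j p)) ` v"
    using v 3 by (intro image_cong) auto
  ultimately show ?thesis
    by (simp add: tilde_comp_def image_Un image_image Un_ac)
qed

lemma tilde_comp_empty_left:
  assumes "u \<subseteq> tilde_pairs m" shows "tilde_comp m 1 {} u = u"
proof -
  have "sh 0 1 ` u = id ` u"
    using assms by (intro image_cong) (auto simp: tilde_pairs_iff subset_iff)
  then show ?thesis
    by (simp add: tilde_comp_def)
qed

lemma tilde_comp_empty_right: "tilde_comp 1 i s {} = s"
proof -
  have "sh i 1 p = p" for p
    by (cases p) auto
  then show ?thesis
    by (simp add: tilde_comp_def image_def)
qed

lemma set_operad_dmts: "set_operad dmts dmt_comp dmt_unit"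
proof
  show "dmts 0 = {}"
    by (auto simp: dmts_def)
  show "n = m" if "x \<in> dmts n" "x \<in> dmts m" for n m x
    using that by (auto simp: dmts_def)
  show "dmt_unit \<in> dmts 1"
    by (auto simp: dmts_def dmt_unit_def)
  show "dmt_comp i x y \<in> dmts (n + m - 1)" if "x \<in> dmts n" "y \<in> dmts m" "i \<in> {1..n}" for x y n m i
    using that tilde_comp_subset[OF _ _ that(3)] by (fastforce simp: dmts_def)
  show "dmt_comp (i + j - 1) (dmt_comp i x y) z = dmt_comp i x (dmt_comp j y z)"
    if "x \<in> dmts n" "y \<in> dmts m" "z \<in> dmts k" "i \<in> {1..n}" "j \<in> {1..m}" for x y z n m k i j
    using that tilde_comp_assoc_sequential[OF _ _ _ that(4,5)] by (auto simp: dmts_def)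
  show "dmt_comp (j + m - 1) (dmt_comp i x y) z = dmt_comp i (dmt_comp j x z) y"
    if "x \<in> dmts n" "y \<in> dmts m" "z \<in> dmts k" "1 \<le> i" "i < j" "j \<le> n" for x y z n m k i j
    using that tilde_comp_assoc_parallel[OF _ _ _ that(4-6)] by (auto simp: dmts_def)
  show "dmt_comp 1 dmt_unit x = x" if "x \<in> dmts n" for x n
    using that by (auto simp: dmts_def dmt_unit_def tilde_comp_empty_left[simplified])
  show "dmt_comp i x dmt_unit = x" if "x \<in> dmts n" "i \<in> {1..n}" for x n i
    using that by (auto simp: dmts_def dmt_unit_def tilde_comp_empty_right[simplified])
qed

text \<open>
  The double multi-tildes of arity \<open>n\<close>, without the three nontrivial ones in the case of arity 1.
\<close>

definition reduced_dmts :: "nat \<Rightarrow> dmt set" where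
  "reduced_dmts n = dmts n - (dmts 1 - {dmt_unit})"

lemma reduced_dmts_subset: "reduced_dmts n \<subseteq> dmts n"
  by (auto simp: reduced_dmts_def)

lemma reduced_dmts_1: "reduced_dmts 1 = {dmt_unit}"
  using set_operad.unit_in[OF set_operad_dmts] by (auto simp: reduced_dmts_def)

lemma reduced_dmts_neq_1: "n \<noteq> 1 \<Longrightarrow> reduced_dmts n = dmts n"
  using set_operad.arity_unique[OF set_operad_dmts] by (auto simp: reduced_dmts_def)

lemma set_operad_reduced_dmts: "set_operad reduced_dmts dmt_comp dmt_unit"
proof (rule set_operad_sub[OF set_operad_dmts])
  interpret set_operad dmts dmt_comp dmt_unit by (rule set_operad_dmts)
  show "reduced_dmts n \<subseteq> dmts n" for n
    by (rule reduced_dmts_subset)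
  show "dmt_unit \<in> reduced_dmts 1"
    by (simp add: reduced_dmts_1[simplified])
  show "dmt_comp i x y \<in> reduced_dmts (n + m - 1)"
    if "x \<in> reduced_dmts n" "y \<in> reduced_dmts m" "i \<in> {1..n}" for x y n m i
  proof (cases "n + m - 1 = 1")
    case False
    then show ?thesis
      using that comp_in reduced_dmts_subset reduced_dmts_neq_1 by blast
  next
    case True
    have "m \<noteq> 0"
      using that(2) reduced_dmts_subset[of 0] arity_0 by (metis empty_iff subset_empty)
    then have "n = 1" "m = 1" "i = 1"
      using True that(3) by auto
    then show ?thesis
      using that reduced_dmts_1 unit_left[OF unit_in] by simp
  qed
qed


section \<open>Double multi-tildes as cliques\<close>

text \<open>The inverse of \<open>dmt_clique\<close>: each component of the labelling is replaced by its zero set.\<close>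

fun clique_dmt :: "(d0 \<times> d0) clique \<Rightarrow> dmt" where
  "clique_dmt (n, p) = (n, {(x, y) \<in> tilde_pairs n. fst (p (x, y + 1)) = D0_zero},
                           {(x, y) \<in> tilde_pairs n. snd (p (x, y + 1)) = D0_zero})"

lemma clique_dmt_dmt_clique:
  assumes "x \<in> dmts n"
  shows "clique_dmt (dmt_clique x) = x"
proof -
  obtain s t where x: "x = (n, s, t)" "s \<subseteq> tilde_pairs n" "t \<subseteq> tilde_pairs n"
    using assms by (auto simp: dmts_def)
  have "(a, b + 1) \<in> arcs n \<longleftrightarrow> (a, b) \<in> tilde_pairs n" for a b
    by (auto simp: arcs_def tilde_pairs_iff)
  then show ?thesis
    using x(2,3) unfolding x(1) by (auto simp: subset_iff)
qed

lemma arcs_1: "arcs 1 = {(1, 2)}"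
  by (auto simp: arcs_def)

lemma tilde_pairs_1: "tilde_pairs 1 = {(1, 1)}"
  by (auto simp: tilde_pairs_def)

lemma D0_sq_simps: "carrier D0_sq = UNIV" "\<one>\<^bsub>D0_sq\<^esub> = (D0_one, D0_one)"
  "(a, b) \<otimes>\<^bsub>D0_sq\<^esub> (a', b') = (d0_mult a a', d0_mult b b')"
  by (auto simp: D0_sq_def D0_def DirProd_def)

lemma bij_betw_dmt_clique: "bij_betw dmt_clique (reduced_dmts n) (cliques D0_sq n)"
proof (rule bij_betw_byWitness[where f' = clique_dmt])
  show "\<forall>x\<in>reduced_dmts n. clique_dmt (dmt_clique x) = x"
    using clique_dmt_dmt_clique reduced_dmts_subset by blast
  show "\<forall>q\<in>cliques D0_sq n. dmt_clique (clique_dmt q) = q"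
  proof
    fix q assume "q \<in> cliques D0_sq n"
    then obtain p where q: "q = (n, p)" and p: "p \<in> arcs n \<rightarrow>\<^sub>E UNIV"
      by (auto simp: cliques_def D0_sq_simps)
    have label: "((if a = D0_zero then D0_zero else D0_one),
        (if b = D0_zero then D0_zero else D0_one)) = (a, b)" for a b
      by (cases a; cases b) auto
    have "restrict (\<lambda>(x, y).
          (if (x, y - 1) \<in> {(x, y) \<in> tilde_pairs n. fst (p (x, y + 1)) = D0_zero}
             then D0_zero else D0_one,
           if (x, y - 1) \<in> {(x, y) \<in> tilde_pairs n. snd (p (x, y + 1)) = D0_zero}
             then D0_zero else D0_one)) (arcs n) = p"
      (is "restrict ?f _ = p")
    proof
      fix e show "restrict ?f (arcs n) e = p e"
      proof (cases "e \<in> arcs n")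
        case True
        then obtain x y where e: "e = (x, y)" "1 \<le> x" "x < y" "y \<le> n + 1"
          by (auto simp: arcs_def)
        then have "(x, y - 1) \<in> tilde_pairs n" "y - 1 + 1 = y"
          by (auto simp: tilde_pairs_iff)
        then show ?thesis
          using True label[of "fst (p e)" "snd (p e)"] by (simp add: e)
      next
        case False
        with p have "p e = undefined"
          by (rule PiE_arb)
        with False show ?thesis
          by (simp only: restrict_apply if_False)
      qed
    qed
    then show "dmt_clique (clique_dmt q) = q"
      by (simp add: q)
  qed
  show "dmt_clique ` reduced_dmts n \<subseteq> cliques D0_sq n"
  proof (cases "n = 1")
    case True
    have "clique_unit D0_sq \<in> cliques D0_sq 1"
      by (auto simp: clique_unit_def cliques_def D0_sq_simps arcs_1[simplified])
    then show ?thesis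
      using True reduced_dmts_1 dmt_clique_unit by simp
  next
    case False
    then show ?thesis
      by (auto simp: reduced_dmts_neq_1 dmts_def cliques_def D0_sq_simps)
  qed
  show "clique_dmt ` cliques D0_sq n \<subseteq> reduced_dmts n"
  proof (cases "n = 1")
    case True
    then show ?thesis
      using reduced_dmts_1 tilde_pairs_1
      by (auto simp: cliques_def D0_sq_simps dmt_unit_def numeral_2_eq_2)
  next
    case False
    then show ?thesis
      by (auto simp: reduced_dmts_neq_1 dmts_def cliques_def)
  qed
qed

lemma mem_sh_image_iff:
  assumes "s \<subseteq> tilde_pairs n" "1 \<le> m" "1 \<le> x" "x < y"
  shows "(x, y - 1) \<in> sh i m ` s \<longleftrightarrow>
    (if y \<le> i then (x, y - 1) \<in> s
     else if x \<le> i \<and> i + m \<le> y then (x, y - m) \<in> s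
     else i + m \<le> x \<and> (x - m + 1, y - m) \<in> s)" (is "_ \<longleftrightarrow> ?R")
proof
  assume "(x, y - 1) \<in> sh i m ` s"
  then obtain a b where ab: "(a, b) \<in> s" "(x, y - 1) = sh i m (a, b)"
    by (auto simp del: sh.simps)
  have bounds: "1 \<le> a" "a \<le> b"
    using ab assms(1) by (auto simp: tilde_pairs_iff)
  consider "b < i" | "a \<le> i" "i \<le> b" | "i < a" "i \<le> b"
    using bounds by linarith
  then show ?R
  proof cases
    case 1
    then have "x = a" "y = b + 1"
      using ab(2) assms(3,4) by auto
    then show ?thesis
      using ab(1) 1 by simp
  next
    case 2
    then have "x = a" "y = b + m"
      using ab(2) assms(2-4) by auto
    then show ?thesis
      using ab(1) 2 assms(2) by simp
  next
    case 3
    then have "x = a + m - 1" "y = b + m"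
      using ab(2) assms(2-4) by auto
    then show ?thesis
      using ab(1) 3 assms(2) by auto
  qed
next
  assume R: ?R
  consider "y \<le> i" | "i < y" "x \<le> i" "i + m \<le> y" | "i < x" "i + m \<le> x"
    using R assms by (auto split: if_splits)
  then show "(x, y - 1) \<in> sh i m ` s"
  proof cases
    case 1
    then have "(x, y - 1) = sh i m (x, y - 1)" using assms by auto
    then show ?thesis using R 1 by (metis image_eqI)
  next
    case 2
    then have "(x, y - 1) = sh i m (x, y - m)" "(x, y - m) \<in> s" using assms R by auto
    then show ?thesis by (metis image_eqI)
  next
    case 3
    then have "(x, y - 1) = sh i m (x - m + 1, y - m)" "(x - m + 1, y - m) \<in> s" using assms R by auto
    then show ?thesis by (metis image_eqI)
  qed
qed

lemma mem_sh_0_image_iff: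
  assumes "u \<subseteq> tilde_pairs m" "1 \<le> i" "1 \<le> x" "x < y"
  shows "(x, y - 1) \<in> sh 0 i ` u \<longleftrightarrow> i \<le> x \<and> y \<le> i + m \<and> (x - i + 1, y - i) \<in> u"
    (is "_ \<longleftrightarrow> ?R")
proof
  assume "(x, y - 1) \<in> sh 0 i ` u"
  then obtain a b where ab: "(a, b) \<in> u" "(x, y - 1) = sh 0 i (a, b)"
    by (auto simp del: sh.simps)
  have bounds: "1 \<le> a" "a \<le> b" "b \<le> m"
    using ab assms(1) by (auto simp: tilde_pairs_iff)
  then have "x = a + i - 1" "y = b + i"
    using ab(2) assms by auto
  then show ?R
    using ab(1) bounds assms(2) by auto
next
  assume R: ?R
  then have "(x, y - 1) = sh 0 i (x - i + 1, y - i)"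
    using assms by auto
  then show "(x, y - 1) \<in> sh 0 i ` u"
    using R by (metis image_eqI)
qed

text \<open>
  Membership in a composite of multi-tildes, in the case distinction of the composition of cliques.
\<close>

lemma mem_tilde_comp_iff:
  assumes "s \<subseteq> tilde_pairs n" "u \<subseteq> tilde_pairs m" "1 \<le> i" "1 \<le> m" "1 \<le> x" "x < y"
  shows "(x, y - 1) \<in> tilde_comp m i s u \<longleftrightarrow>
    (if y \<le> i then (x, y - 1) \<in> s
     else if x \<le> i \<and> i + m \<le> y \<and> (x, y) \<noteq> (i, i + m) then (x, y - m) \<in> s
     else if i + m \<le> x then (x - m + 1, y - m) \<in> s
     else if i \<le> x \<and> y \<le> i + m \<and> (x, y) \<noteq> (i, i + m) then (x - i + 1, y - i) \<in> u
     else (x, y) = (i, i + m) \<and> ((i, i) \<in> s \<or> (1, m) \<in> u))"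
proof -
  note mem = tilde_comp_def Un_iff mem_sh_image_iff[OF assms(1,4-6)]
    mem_sh_0_image_iff[OF assms(2,3,5,6)]
  consider (left) "y \<le> i" | (over) "i < y" "x \<le> i" "i + m \<le> y"
    | (right) "i < y" "i < x" "i + m \<le> x"
    | (below) "i < y" "\<not> (x \<le> i \<and> i + m \<le> y)" "x < i + m"
    using assms(4) by linarith
  then show ?thesis
  proof cases
    case left
    then show ?thesis
      using assms(6) unfolding mem by simp
  next
    case over
    show ?thesis
    proof (cases "(x, y) = (i, i + m)")
      case True
      then show ?thesis
        using assms(4) unfolding mem by simp
    next
      case False
      then have "\<not> (i \<le> x \<and> y \<le> i + m)"
        using over by auto
      then show ?thesis
        using over False unfolding mem by auto
    qed
  next
    case right
    then have "\<not> (x \<le> i \<and> i + m \<le> y)" "\<not> y \<le> i + m"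
      using assms(6) by auto
    then show ?thesis
      using right unfolding mem by simp
  next
    case below
    then have "(x, y) \<noteq> (i, i + m)"
      by auto
    then show ?thesis
      using below unfolding mem by auto
  qed
qed

lemma dmt_clique_comp:
  assumes "a \<in> dmts n" "b \<in> dmts m" "i \<in> {1..n}"
  shows "dmt_clique (dmt_comp i a b) = clique_comp D0_sq i (dmt_clique a) (dmt_clique b)"
proof -
  obtain s t u v where ab: "a = (n, s, t)" "b = (m, u, v)" and "1 \<le> m"
    and sub: "s \<subseteq> tilde_pairs n" "t \<subseteq> tilde_pairs n" "u \<subseteq> tilde_pairs m" "v \<subseteq> tilde_pairs m"
    using assms by (auto simp: dmts_def)
  have i: "1 \<le> i" "i \<le> n"
    using assms(3) by auto
  note mem = mem_tilde_comp_iff[OF sub(1,3) i(1) \<open>1 \<le> m\<close>] mem_tilde_comp_iff[OF sub(2,4) i(1) \<open>1 \<le> m\<close>]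
  let ?p = "restrict (\<lambda>(x, y). (if (x, y - 1) \<in> s then D0_zero else D0_one,
      if (x, y - 1) \<in> t then D0_zero else D0_one)) (arcs n)"
  let ?q = "restrict (\<lambda>(x, y). (if (x, y - 1) \<in> u then D0_zero else D0_one,
      if (x, y - 1) \<in> v then D0_zero else D0_one)) (arcs m)"
  have label: "(if (x, y - 1) \<in> tilde_comp m i s u then D0_zero else D0_one,
      if (x, y - 1) \<in> tilde_comp m i t v then D0_zero else D0_one) =
      (if y \<le> i then ?p (x, y)
       else if x \<le> i \<and> i + m \<le> y \<and> (x, y) \<noteq> (i, i + m) then ?p (x, y - m + 1)
       else if i + m \<le> x then ?p (x - m + 1, y - m + 1)
       else if i \<le> x \<and> y \<le> i + m \<and> (x, y) \<noteq> (i, i + m) then ?q (x - i + 1, y - i + 1)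
       else if (x, y) = (i, i + m) then ?p (i, i + 1) \<otimes>\<^bsub>D0_sq\<^esub> ?q (1, m + 1)
       else \<one>\<^bsub>D0_sq\<^esub>)"
      \<comment> \<open>The cases follow the branches in the definition of the composition of cliques.\<close>
    if "(x, y) \<in> arcs (n + m - 1)" for x y
  proof -
    from that have xy: "1 \<le> x" "x < y" "y \<le> n + m"
      using i by (auto simp: arcs_def)
    let ?over = "x \<le> i \<and> i + m \<le> y \<and> (x, y) \<noteq> (i, i + m)"
    let ?inside = "i \<le> x \<and> y \<le> i + m \<and> (x, y) \<noteq> (i, i + m)"
    consider (left) "y \<le> i" | (over) "\<not> y \<le> i" "?over"
      | (right) "\<not> y \<le> i" "\<not> ?over" "i + m \<le> x"
      | (inside) "\<not> y \<le> i" "\<not> ?over" "\<not> i + m \<le> x" "?inside"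
      | (base) "(x, y) = (i, i + m)"
      | (crossing) "\<not> y \<le> i" "\<not> ?over" "\<not> i + m \<le> x" "\<not> ?inside" "(x, y) \<noteq> (i, i + m)"
      by blast
    then show ?thesis
    proof cases
      case left
      then have "(x, y) \<in> arcs n"
        using xy i by (simp add: arcs_def)
      then show ?thesis
        unfolding mem[OF xy(1,2)] if_P[OF left] by simp
    next
      case over
      then have "(x, y - m + 1) \<in> arcs n"
        using xy \<open>1 \<le> m\<close> by (auto simp: arcs_def)
      then show ?thesis
        unfolding mem[OF xy(1,2)] if_not_P[OF over(1)] if_P[OF over(2)] by simp
    next
      case right
      then have "(x - m + 1, y - m + 1) \<in> arcs n"
        using xy \<open>1 \<le> m\<close> i by (auto simp: arcs_def)
      then show ?thesis
        unfolding mem[OF xy(1,2)] if_not_P[OF right(1)] if_not_P[OF right(2)] if_P[OF right(3)] by simp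
    next
      case inside
      then have "(x - i + 1, y - i + 1) \<in> arcs m"
        using xy i by (auto simp: arcs_def)
      then show ?thesis
        unfolding mem[OF xy(1,2)] if_not_P[OF inside(1)] if_not_P[OF inside(2)] if_not_P[OF inside(3)]
          if_P[OF inside(4)] by simp
    next
      case base
      have "(i, i + 1) \<in> arcs n" "(1, m + 1) \<in> arcs m"
        using i \<open>1 \<le> m\<close> by (auto simp: arcs_def)
      then show ?thesis
        unfolding mem[OF xy(1,2)] using base \<open>1 \<le> m\<close> by (simp add: D0_sq_simps)
    next
      case crossing
      show ?thesis
        unfolding mem[OF xy(1,2)] if_not_P[OF crossing(1)] if_not_P[OF crossing(2)] if_not_P[OF crossing(3)]
          if_not_P[OF crossing(4)] if_not_P[OF crossing(5)]
        using crossing(5) by (auto simp: D0_sq_simps)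
    qed
  qed
  show ?thesis
    unfolding ab dmt_comp.simps dmt_clique.simps clique_comp.simps prod.inject
    by (intro conjI refl restrict_ext) (clarify, simp only: prod.case label prod.inject)
qed


section \<open>The isomorphism\<close>

lemma set_operad_iso_dmt_clique:
  "set_operad_iso dmt_clique reduced_dmts dmt_comp dmt_unit
     (cliques D0_sq) (clique_comp D0_sq) (clique_unit D0_sq)"
proof (rule set_operad_transport[OF set_operad_reduced_dmts bij_betw_dmt_clique _ dmt_clique_unit])
  show "n = m" if "x \<in> cliques D0_sq n" "x \<in> cliques D0_sq m" for n m x
    using that by (auto simp: cliques_def)
  show "dmt_clique (dmt_comp i x y) = clique_comp D0_sq i (dmt_clique x) (dmt_clique y)"
    if "x \<in> reduced_dmts n" "y \<in> reduced_dmts m" "i \<in> {1..n}" for n m x y i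
    using that reduced_dmts_subset by (intro dmt_clique_comp) auto
qed

lemma DMT_eq_linearize: "DMT = linearize dmts dmt_comp dmt_unit"
  by (simp add: DMT_def linearize_def)

lemma DMT_reduced_eq_linearize: "DMT_reduced = linearize reduced_dmts dmt_comp dmt_unit"
  by (simp add: DMT_reduced_def DMT_def linearize_def reduced_dmts_def)

lemma clique_operad_eq_linearize:
  "clique_operad M = linearize (cliques M) (clique_comp M) (clique_unit M)"
  by (simp add: clique_operad_def linearize_def)

lemma suboperad_DMT_reduced:
  "suboperad (DMT_reduced :: ('k::field, dmt \<Rightarrow>\<^sub>0 'k) ns_operad) DMT"
  unfolding suboperad_def DMT_eq_linearize DMT_reduced_eq_linearize
  using reduced_dmts_subset
  by (intro conjI ns_operad_linearize set_operad_dmts set_operad_reduced_dmts)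
     (fastforce simp: linearize_def lin_span_eq_keys)+

theorem proposition4p1p2:
  shows "suboperad (DMT_reduced :: ('k::field_char_0, dmt \<Rightarrow>\<^sub>0 'k) ns_operad) DMT \<and>
         operads_isomorphic
           (clique_operad D0_sq :: ('k, (d0 \<times> d0) clique \<Rightarrow>\<^sub>0 'k) ns_operad)
           (DMT_reduced :: ('k, dmt \<Rightarrow>\<^sub>0 'k) ns_operad) \<and>
         operad_iso phi_DMT
           (DMT_reduced :: ('k, dmt \<Rightarrow>\<^sub>0 'k) ns_operad)
           (clique_operad D0_sq :: ('k, (d0 \<times> d0) clique \<Rightarrow>\<^sub>0 'k) ns_operad)"
proof (intro conjI suboperad_DMT_reduced)
  have "set_operad_iso clique_dmt (cliques D0_sq) (clique_comp D0_sq) (clique_unit D0_sq)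
      reduced_dmts dmt_comp dmt_unit"
    using set_operad_iso_dmt_clique clique_dmt_dmt_clique reduced_dmts_subset
    by (blast intro: set_operad_iso_inverse)
  then show "operads_isomorphic
      (clique_operad D0_sq :: ('k, (d0 \<times> d0) clique \<Rightarrow>\<^sub>0 'k) ns_operad) DMT_reduced"
    unfolding operads_isomorphic_def clique_operad_eq_linearize DMT_reduced_eq_linearize
    by (intro exI) (rule operad_iso_lin_ext)
  show "operad_iso phi_DMT (DMT_reduced :: ('k, dmt \<Rightarrow>\<^sub>0 'k) ns_operad) (clique_operad D0_sq)"
    unfolding phi_DMT_def clique_operad_eq_linearize DMT_reduced_eq_linearize
    by (rule operad_iso_lin_ext[OF set_operad_iso_dmt_clique])
qed

end
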